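(* Let $n$ be a positive integer, let $C\subseteq[n]$, let $\mathcal H\subseteq 2^{[n]\setminus C}$ be a family of subsets of $[n]\setminus C$, and let $\alpha_H\ge 0$ be a real number for each $H\in\mathcal H$. Define $\phi:\{0,1\}^n\to\mathbb R$ by $$\phi(x)=-\sum_{H\in\mathcal H}\alpha_H\prod_{j\in H\cup C}x_j .$$ Then for all $x\in\{0,1\}^n$, $$\phi(x)=\min_{w\in\{0,1\}}\ \sum_{H\in\mathcal H}\alpha_H\, w\left(1-\prod_{j\in C}x_j-\prod_{j\in H}x_j\right).$$
   Context: $[n]=\{1,2,\dots,n\}$ and $2^{[n]\setminus C}$ denotes the family of all subsets of $[n]\setminus C$. Empty sums equal $0$ and empty products equal $1$. *)

theory Defs
  imports Complex_Main "HOL-Library.FuncSet"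
begin

text \<open>The cube $\{0,1\}^n$: functions on \<open>{1..n}\<close>, extended by \<open>undefined\<close> elsewhere, with
  values the real numbers 0 and 1.\<close>

definition bool_cube :: "nat \<Rightarrow> (nat \<Rightarrow> real) set" where
  "bool_cube n = {1..n} \<rightarrow>\<^sub>E {0, 1}"

definition phi :: "nat set \<Rightarrow> nat set set \<Rightarrow> (nat set \<Rightarrow> real) \<Rightarrow> (nat \<Rightarrow> real) \<Rightarrow> real" where
  "phi C \<H> \<alpha> x = - (\<Sum>H\<in>\<H>. \<alpha> H * (\<Prod>j\<in>H \<union> C. x j))"

end

theory Submission
  imports Defs
begin

text \<open>The objective vanishes at w = 0, so the minimum is min(0, S) with S its value at w = 1.
  Let p and q_H be the products over C and H; by \<open>prod_zero_one\<close> they are 0 or 1. Since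
  H and C are disjoint, phi = -p * (sum of \<alpha>_H q_H). The value of p decides which choice of w
  is optimal.\<close>

lemma prod_zero_one:
  fixes f :: "'a \<Rightarrow> 'b::semidom"
  assumes "\<And>j. j \<in> A \<Longrightarrow> f j \<in> {0, 1}"
  shows "prod f A \<in> {0, 1}"
  using assms
\<comment> \<open>For infinite \<open>A\<close> the product has the default value 1.\<close>
proof (induction A rule: infinite_finite_induct)
  case (insert a A)
  then have "f a \<in> {0, 1}" "prod f A \<in> {0, 1}" by blast+
  with insert.hyps show ?case by (auto simp del: prod_zero_iff)
qed simp_all

theorem theorem3:
  fixes n :: nat and C :: "nat set" and \<H> :: "nat set set" and \<alpha> :: "nat set \<Rightarrow> real"
  assumes "n \<ge> 1"
    and "C \<subseteq> {1..n}"
    and "\<H> \<subseteq> Pow ({1..n} - C)"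
    and "\<forall>H\<in>\<H>. \<alpha> H \<ge> 0"
  shows "\<forall>x\<in>bool_cube n.
           phi C \<H> \<alpha> x =
             (MIN w\<in>{0, 1}. \<Sum>H\<in>\<H>. \<alpha> H * w * (1 - (\<Prod>j\<in>C. x j) - (\<Prod>j\<in>H. x j)))"
proof
  fix x assume "x \<in> bool_cube n"
  then have x: "x j \<in> {0, 1}" if "j \<in> {1..n}" for j
    using that by (auto simp: bool_cube_def PiE_iff)
  define p where "p = (\<Prod>j\<in>C. x j)"
  define q where "q H = (\<Prod>j\<in>H. x j)" for H
  have p: "p \<in> {0, 1}"
    unfolding p_def by (intro prod_zero_one x) (use assms(2) in blast)
  have q: "q H \<in> {0, 1}" if "H \<in> \<H>" for H
    unfolding q_def by (intro prod_zero_one x) (use assms(3) that in blast)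
  have "(\<Prod>j\<in>H \<union> C. x j) = q H * p" if "H \<in> \<H>" for H
    unfolding p_def q_def
    by (rule prod.union_disjoint) (use assms(2,3) that in \<open>auto intro: finite_subset\<close>)
  then have phi: "phi C \<H> \<alpha> x = - (\<Sum>H\<in>\<H>. \<alpha> H * (q H * p))"
    by (simp add: phi_def)
  have "phi C \<H> \<alpha> x = min 0 (\<Sum>H\<in>\<H>. \<alpha> H * (1 - p - q H))"
  proof (cases "p = 1")
    case True
    \<comment> \<open>For p = 1 the bracket is -q_H, so S equals phi and is at most 0: w = 1 is
      optimal.\<close>
    have "0 \<le> (\<Sum>H\<in>\<H>. \<alpha> H * q H)"
      by (rule sum_nonneg) (use assms(4) q in fastforce)
    then show ?thesis
      using True by (simp add: phi sum_negf)
  next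
    case False
    with p have "p = 0" by simp
    \<comment> \<open>For p = 0 phi vanishes, and S is nonnegative because q_H \<le> 1: w = 0 is
      optimal.\<close>
    moreover have "0 \<le> (\<Sum>H\<in>\<H>. \<alpha> H * (1 - q H))"
      by (rule sum_nonneg) (use assms(4) q in fastforce)
    ultimately show ?thesis by (simp add: phi)
  qed
  \<comment> \<open>Evaluating the objective at the two values of w turns \<open>MIN\<close> into
    the binary \<open>min\<close>.\<close>
  then show "phi C \<H> \<alpha> x =
      (MIN w\<in>{0, 1}. \<Sum>H\<in>\<H>. \<alpha> H * w * (1 - (\<Prod>j\<in>C. x j) - (\<Prod>j\<in>H. x j)))"
    by (simp add: p_def q_def)
qed

end
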